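(* Let $H$ be a bipartite graph. Then $H$ is bipartite $\mathbb{Z}^d$-Kirszbraun if and only if $H$ is bipartite $(2d,2)$-Helly.
   Context: Here $d\ge 1$ is an integer. All graphs are nonempty, connected and simple (no loops or multiple edges). A graph is identified with its vertex set, endowed with the path metric. $\mathbb{Z}^d$ is the Cayley graph of the group $\mathbb{Z}^d$ with respect to the standard generators. For graphs $G,H$, $\mathrm{Hom}(G,H)$ denotes the set of graph homomorphisms (adjacency-preserving maps between the vertices) from $G$ to $H$. A ball in $H$ is a set of the form $\{w\in H: d_H(v,w)\le r\}$ with $v\in H$ and $r\in\mathbb{N}$, where $d_H$ is the path metric. A bipartite graph $H$ is called bipartite $(n,m)$-Helly if for all balls $B_1,B_2,\dots,B_n$ in $H$ (if $n\neq\infty$, and any finite collection of balls otherwise) and any partite class $H_1$ of $H$: if any subcollection of size $m$ among $B_1\cap H_1,\dots,B_n\cap H_1$ has a nonempty intersection, then $\bigcap_{i=1}^n B_i\cap H_1\neq\varnothing$. Let $G,H$ be bipartite graphs with partite classes $G_1,G_2$ and $H_1,H_2$ respectively. The graph $H$ is called bipartite $G$-Kirszbraun if for all subsets $A\subset G$ (with the metric restricted from $G$) and all $1$-Lipschitz maps $f:A\to H$ for which $f(A\cap G_1)\subset H_1$ and $f(A\cap G_2)\subset H_2$, there exists $\tilde f\in\mathrm{Hom}(G,H)$ extending $f$.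
   Formalization: A bipartite graph is taken to have two nonempty partite classes, which excludes only the one-vertex graph; that graph is bipartite (2d,2)-Helly but admits no homomorphism from Z^d, so the claim fails for it. *)

theory Defs
  imports "HOL-Analysis.Finite_Cartesian_Product"
begin

record 'v graph =
  verts :: "'v set"
  edges :: "('v \<times> 'v) set"

text \<open>Undirected graphs, given by a symmetric irreflexive edge relation. They may be infinite, and
  need not be locally finite.\<close>

definition simple_connected_graph :: "'v graph \<Rightarrow> bool" where
  "simple_connected_graph G \<longleftrightarrow>
     verts G \<noteq> {} \<and> edges G \<subseteq> verts G \<times> verts G \<and> sym (edges G) \<and> irrefl (edges G) \<and>
     (\<forall>u\<in>verts G. \<forall>v\<in>verts G. (u, v) \<in> (edges G)\<^sup>*)"

text \<open>The path metric: a walk of length \<open>n\<close> from \<open>u\<close> to \<open>v\<close> is a witness of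
  \<open>(u, v) \<in> edges G ^^ n\<close>. Only meaningful when such a walk exists, in particular on connected
  graphs.\<close>

definition gdist :: "'v graph \<Rightarrow> 'v \<Rightarrow> 'v \<Rightarrow> nat" where
  "gdist G u v = (LEAST n. (u, v) \<in> edges G ^^ n)"

definition graph_homs :: "'v graph \<Rightarrow> 'w graph \<Rightarrow> ('v \<Rightarrow> 'w) set" where
  "graph_homs G H =
     {h. (\<forall>x\<in>verts G. h x \<in> verts H) \<and> (\<forall>x y. (x, y) \<in> edges G \<longrightarrow> (h x, h y) \<in> edges H)}"

definition balls :: "'v graph \<Rightarrow> 'v set set" where
  "balls H = {{w \<in> verts H. gdist H v w \<le> r} | v r. v \<in> verts H}"

text \<open>The blocks of a partition are nonempty, so that a bipartite graph has two nonempty partite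
  classes. For a connected graph this excludes only the one-vertex graph, which admits no
  homomorphism from any graph with an edge although all of its balls coincide.\<close>

definition partite_classes :: "'v graph \<Rightarrow> 'v set \<Rightarrow> 'v set \<Rightarrow> bool" where
  "partite_classes G G1 G2 \<longleftrightarrow>
     G1 \<noteq> {} \<and> G2 \<noteq> {} \<and> G1 \<inter> G2 = {} \<and> G1 \<union> G2 = verts G \<and>
     (\<forall>x y. (x, y) \<in> edges G \<longrightarrow> \<not> (x \<in> G1 \<and> y \<in> G1) \<and> \<not> (x \<in> G2 \<and> y \<in> G2))"

definition bipartite :: "'v graph \<Rightarrow> bool" where
  "bipartite G \<longleftrightarrow> (\<exists>G1 G2. partite_classes G G1 G2)"

text \<open>The balls form an indexed family (repetitions allowed), and a subcollection of size \<open>m\<close> is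
  given by a set of \<open>m\<close> indices. Only finite \<open>n\<close> is covered. As \<open>partite_classes\<close> is symmetric,
  \<open>H1\<close> ranges over both classes.\<close>

definition bipartite_helly :: "nat \<Rightarrow> nat \<Rightarrow> 'v graph \<Rightarrow> bool" where
  "bipartite_helly n m H \<longleftrightarrow>
     (\<forall>B H1 H2. (\<forall>i\<in>{1..n}. B i \<in> balls H) \<longrightarrow> partite_classes H H1 H2 \<longrightarrow>
        (\<forall>I. I \<subseteq> {1..n} \<and> card I = m \<longrightarrow> (\<Inter>i\<in>I. B i \<inter> H1) \<noteq> {}) \<longrightarrow>
        (\<Inter>i\<in>{1..n}. B i) \<inter> H1 \<noteq> {})"

text \<open>The property is required for every labelling of the partite classes of \<open>G\<close> and \<open>H\<close>. The
  values of \<open>f\<close> outside \<open>A\<close> do not matter.\<close>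

definition bipartite_kirszbraun :: "'v graph \<Rightarrow> 'w graph \<Rightarrow> bool" where
  "bipartite_kirszbraun G H \<longleftrightarrow>
     (\<forall>G1 G2 H1 H2. partite_classes G G1 G2 \<longrightarrow> partite_classes H H1 H2 \<longrightarrow>
        (\<forall>A f. A \<subseteq> verts G \<longrightarrow> f ` A \<subseteq> verts H \<longrightarrow>
           (\<forall>x\<in>A. \<forall>y\<in>A. gdist H (f x) (f y) \<le> gdist G x y) \<longrightarrow>
           f ` (A \<inter> G1) \<subseteq> H1 \<longrightarrow> f ` (A \<inter> G2) \<subseteq> H2 \<longrightarrow>
           (\<exists>h \<in> graph_homs G H. \<forall>x\<in>A. h x = f x)))"

text \<open>The Cayley graph of the integer lattice of dimension \<open>CARD('d)\<close>, with generators the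
  standard basis vectors \<open>axis i 1\<close>.\<close>

definition int_lattice :: "(int ^ 'd) graph" where
  "int_lattice = \<lparr>verts = UNIV,
     edges = {(x, y). \<exists>i. y = x + axis i 1 \<or> y = x - axis i 1}\<rparr>"

lemma bipartite_int_lattice: "bipartite (int_lattice :: (int ^ 'd) graph)"
proof -
  let ?s = "\<lambda>x :: int ^ 'd. \<Sum>i\<in>UNIV. x $ i"
  have ax: "?s (axis i 1) = 1" for i
    by (simp add: axis_def)
  have "partite_classes (int_lattice :: (int ^ 'd) graph) {x. even (?s x)} {x. odd (?s x)}"
    unfolding partite_classes_def int_lattice_def
  proof (intro conjI)
    have "0 \<in> {x. even (?s x)}" by simp
    then show "{x. even (?s x)} \<noteq> {}" by blast
    have "axis undefined 1 \<in> {x. odd (?s x)}" by (simp add: ax)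
    then show "{x. odd (?s x)} \<noteq> {}" by blast
  qed (auto simp: sum.distrib sum_subtractf ax)
  then show ?thesis unfolding bipartite_def by blast
qed

end

theory Submission
  imports Defs
begin

text \<open>Since \<open>H\<close> is bipartite, a map between the lattice and \<open>H\<close> is \<open>1\<close>-Lipschitz and respects the
  classes iff points at distance \<open>n\<close> go to vertices joined by a walk of length exactly \<open>n\<close>; likewise
  for balls intersected with a class. The Kirszbraun property yields the Helly property by placing
  the centres of \<open>2d\<close> balls on the \<open>2d\<close> half-axes and evaluating an extension at the origin.

  Conversely, one extends a map from \<open>A\<close> to one further point \<open>x\<close>. If \<open>b\<close> lies in the box spanned by \<open>x\<close>
  and \<open>a\<close>, the condition at \<open>b\<close> implies the one at \<open>a\<close>, so by Dickson's lemma a finite subset of \<open>A\<close>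
  suffices. If it has at most \<open>2d\<close> points, the Helly property applies. Otherwise some \<open>a\<close> is, in each of
  the \<open>2d\<close> directions, not the unique extreme point of \<open>A\<close>. Move from \<open>x\<close> one step towards \<open>a\<close>, to
  \<open>x'\<close>: the step also leads towards another point \<open>b\<close>. By induction on the distance to \<open>a\<close> the map
  extends to \<open>x'\<close>, and then \<open>x'\<close> replaces both \<open>a\<close> and \<open>b\<close>, which leaves fewer points.\<close>

section \<open>Walks of prescribed length\<close>

lemma sym_relpow: "sym R \<Longrightarrow> sym (R ^^ n)"
proof (induction n)
  case (Suc n)
  then have "R O R ^^ n \<subseteq> (R O R ^^ n)\<inverse>"
    by (auto simp: sym_conv_converse_eq converse_relcomp relpow_commute)
  then show ?case
    by (auto simp: sym_def relpow_commute)
qed (auto simp: sym_def)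

lemma relpow_addE:
  assumes "(x, z) \<in> R ^^ (m + n)"
  obtains y where "(x, y) \<in> R ^^ m" "(y, z) \<in> R ^^ n"
  using assms by (auto simp: relpow_add)

lemma graph_homs_relpow:
  assumes "h \<in> graph_homs G H" "(x, y) \<in> edges G ^^ n"
  shows "(h x, h y) \<in> edges H ^^ n"
  using assms(2)
proof (induction n arbitrary: y)
  case (Suc n)
  then obtain z where z: "(x, z) \<in> edges G ^^ n" "(z, y) \<in> edges G" by auto
  then have "(h z, h y) \<in> edges H" using assms(1) unfolding graph_homs_def by blast
  with Suc.IH[OF z(1)] show ?case by (rule relpow_Suc_I)
qed simp

lemma gdist_le: "(u, v) \<in> edges G ^^ n \<Longrightarrow> gdist G u v \<le> n"
  unfolding gdist_def by (rule Least_le)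

lemma partite_classes_swap: "partite_classes G G1 G2 \<Longrightarrow> partite_classes G G2 G1"
  unfolding partite_classes_def by blast

lemma partite_classes_walk:
  assumes "partite_classes G G1 G2" "edges G \<subseteq> verts G \<times> verts G" "(x, y) \<in> edges G ^^ n"
  shows "x \<in> G1 \<longleftrightarrow> (y \<in> G1 \<longleftrightarrow> even n)"
  using assms(3)
proof (induction n arbitrary: y)
  case (Suc n)
  then obtain z where z: "(x, z) \<in> edges G ^^ n" "(z, y) \<in> edges G" by auto
  have "z \<in> G1 \<longleftrightarrow> y \<notin> G1"
    using z(2) assms(1,2) unfolding partite_classes_def by blast
  with Suc.IH[OF z(1)] show ?case by auto
qed simp

locale connected_bipartite_graph =
  fixes H :: "'v graph"
  assumes connected: "simple_connected_graph H" and bip: "bipartite H"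
begin

lemma edges_verts: "edges H \<subseteq> verts H \<times> verts H"
  and sym_edges: "sym (edges H)"
  and verts_nonempty: "verts H \<noteq> {}"
  using connected unfolding simple_connected_graph_def by auto

lemma walk_sym: "(u, v) \<in> edges H ^^ n \<Longrightarrow> (v, u) \<in> edges H ^^ n"
  using sym_relpow[OF sym_edges] by (auto dest: symD)

lemma walk_verts: "(u, v) \<in> edges H ^^ n \<Longrightarrow> u \<in> verts H \<Longrightarrow> v \<in> verts H"
  using edges_verts by (cases n) auto

lemma gdist_walk:
  assumes "u \<in> verts H" "v \<in> verts H"
  shows "(u, v) \<in> edges H ^^ gdist H u v"
proof -
  have "(u, v) \<in> (edges H)\<^sup>*"
    using assms connected unfolding simple_connected_graph_def by blast
  then have "\<exists>n. (u, v) \<in> edges H ^^ n" by (simp add: rtrancl_is_UN_relpow)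
  then show ?thesis unfolding gdist_def by (rule LeastI_ex)
qed

text \<open>Both partite classes are nonempty, so there is a vertex other than \<open>u\<close>, and
  a path to it has a first edge.\<close>

lemma neighbour_exists:
  assumes "u \<in> verts H"
  obtains v where "(u, v) \<in> edges H"
proof -
  obtain H1 H2 where "partite_classes H H1 H2" using bip unfolding bipartite_def by blast
  then obtain w where w: "w \<in> verts H" "w \<noteq> u"
    unfolding partite_classes_def by blast
  then have "(u, w) \<in> (edges H)\<^sup>*"
    using assms connected unfolding simple_connected_graph_def by blast
  with w that show thesis by (metis converse_rtranclE)
qed

text \<open>The surplus length is even and is used up by going back and forth along one edge at
  \<open>u\<close>.\<close>

lemma walk_extend:
  assumes "(u, v) \<in> edges H ^^ m" "u \<in> verts H" "m \<le> n" "even m \<longleftrightarrow> even n"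
  shows "(u, v) \<in> edges H ^^ n"
proof -
  obtain w where w: "(u, w) \<in> edges H" using neighbour_exists assms(2) .
  then have "(w, u) \<in> edges H" using sym_edges by (auto dest: symD)
  with w have loop: "(u, u) \<in> edges H ^^ 2" by (auto simp: numeral_2_eq_2)
  have "(u, u) \<in> edges H ^^ (2 * k)" for k
  proof (induction k)
    case (Suc k)
    from relpow_trans[OF loop this] show ?case by simp
  qed simp
  then have "(u, v) \<in> edges H ^^ (2 * ((n - m) div 2) + m)"
    using assms(1) by (rule relpow_trans)
  moreover have "2 * ((n - m) div 2) + m = n" using assms(3,4) by presburger
  ultimately show ?thesis by simp
qed

text \<open>Dictionary between metric and walks: the exact length of a walk records the distance
  bound and, through its parity, how the classes of its two ends are related.\<close>

lemma walk_iff_gdist: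
  assumes "partite_classes H H1 H2" "u \<in> verts H" "v \<in> verts H"
  shows "(u, v) \<in> edges H ^^ n \<longleftrightarrow> gdist H u v \<le> n \<and> (u \<in> H1 \<longleftrightarrow> (v \<in> H1 \<longleftrightarrow> even n))"
proof
  assume "(u, v) \<in> edges H ^^ n"
  then show "gdist H u v \<le> n \<and> (u \<in> H1 \<longleftrightarrow> (v \<in> H1 \<longleftrightarrow> even n))"
    using partite_classes_walk[OF assms(1) edges_verts] gdist_le by metis
next
  assume "gdist H u v \<le> n \<and> (u \<in> H1 \<longleftrightarrow> (v \<in> H1 \<longleftrightarrow> even n))"
  then show "(u, v) \<in> edges H ^^ n"
    using walk_extend[OF gdist_walk] assms(2,3)
      partite_classes_walk[OF assms(1) edges_verts gdist_walk[OF assms(2,3)]] by blast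
qed

section \<open>The Helly property in terms of walks\<close>

text \<open>A pair \<open>(p, r)\<close> stands for the ball of radius \<open>r\<close> about
  \<open>p\<close>, cut down to the class in which walks of length \<open>r\<close> from
  \<open>p\<close> end. Two such sets meet iff a walk of length \<open>r + s\<close> joins the
  centres, since it can be split after \<open>r\<close> steps.\<close>

definition walk_helly :: "nat \<Rightarrow> bool" where
  "walk_helly n \<longleftrightarrow>
     (\<forall>S. finite S \<longrightarrow> card S \<le> n \<longrightarrow> fst ` S \<subseteq> verts H \<longrightarrow>
        (\<forall>(p, r)\<in>S. \<forall>(q, s)\<in>S. (p, q) \<in> edges H ^^ (r + s)) \<longrightarrow>
        (\<exists>y\<in>verts H. \<forall>(p, r)\<in>S. (y, p) \<in> edges H ^^ r))"

lemma walk_hellyD: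
  assumes "walk_helly n" "finite S" "card S \<le> n" "fst ` S \<subseteq> verts H"
    "\<And>p r q s. (p, r) \<in> S \<Longrightarrow> (q, s) \<in> S \<Longrightarrow> (p, q) \<in> edges H ^^ (r + s)"
  obtains y where "y \<in> verts H" "\<And>p r. (p, r) \<in> S \<Longrightarrow> (y, p) \<in> edges H ^^ r"
proof -
  have "\<forall>(p, r)\<in>S. \<forall>(q, s)\<in>S. (p, q) \<in> edges H ^^ (r + s)"
    using assms(5) by (intro ballI) (clarsimp split: prod.splits)
  from assms(1)[unfolded walk_helly_def, THEN spec, THEN mp, OF assms(2), THEN mp, OF assms(3),
      THEN mp, OF assms(4), THEN mp, OF this]
  obtain y where y: "y \<in> verts H" "\<forall>(p, r)\<in>S. (y, p) \<in> edges H ^^ r" ..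
  show thesis by (rule that[OF y(1)]) (use y(2) in auto)
qed

text \<open>Exchanging the two labels negates membership of \<open>p\<close> in the first
  class.\<close>

lemma labelling_exists:
  assumes "p \<in> verts H"
  obtains H1 H2 where "partite_classes H H1 H2" "p \<in> H1 \<longleftrightarrow> P"
proof -
  obtain H1 H2 where "partite_classes H H1 H2" using bip unfolding bipartite_def by blast
  moreover from this have "partite_classes H H2 H1" by (rule partite_classes_swap)
  moreover have "p \<in> H2 \<longleftrightarrow> p \<notin> H1"
    using assms calculation(1) unfolding partite_classes_def by blast
  ultimately show thesis using that by blast
qed

lemma walk_helly_if_bipartite_helly:
  assumes "bipartite_helly n 2 H"
  shows "walk_helly n"
  unfolding walk_helly_def
proof (intro allI impI)
  fix S :: "('v \<times> nat) set"
  assume S: "finite S" "card S \<le> n" "fst ` S \<subseteq> verts H"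
    and pw: "\<forall>(p, r)\<in>S. \<forall>(q, s)\<in>S. (p, q) \<in> edges H ^^ (r + s)"
  show "\<exists>y\<in>verts H. \<forall>(p, r)\<in>S. (y, p) \<in> edges H ^^ r"
  proof (cases "S = {}")
    case True
    then show ?thesis using verts_nonempty by auto
  next
    case False
    then obtain p0 r0 where s0: "(p0, r0) \<in> S" by auto
    then have "p0 \<in> verts H" using S(3) by force
    \<comment> \<open>\<open>H1\<close> is made the class in which walks of length \<open>r0\<close>
      from \<open>p0\<close> end. The walks between centres then give the same for every pair in
      \<open>S\<close>.\<close>
    then obtain H1 H2 where pc: "partite_classes H H1 H2" and p0: "p0 \<in> H1 \<longleftrightarrow> even r0"
      by (rule labelling_exists)
    note par = partite_classes_walk[OF pc edges_verts]
    have H1V: "H1 \<subseteq> verts H" using pc unfolding partite_classes_def by blast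
    have cls: "p \<in> H1 \<longleftrightarrow> even r" if "(p, r) \<in> S" for p r
      using pw s0 that p0 par[of p0 p "r0 + r"] by fastforce
    \<comment> \<open>The Helly property takes a family of exactly \<open>n\<close> balls, so
      \<open>S\<close> is enumerated with \<open>(p0, r0)\<close> repeated at the surplus
      indices.\<close>
    obtain e where e: "e ` {1..n} = S"
    proof -
      obtain k where k: "bij_betw k {1..card S} S"
        using ex_bij_betw_nat_finite_1[OF S(1)] by blast
      have "S = (\<lambda>i. if i \<le> card S then k i else (p0, r0)) ` {1..n}"
      proof
        show "S \<subseteq> (\<lambda>i. if i \<le> card S then k i else (p0, r0)) ` {1..n}"
        proof
          fix s assume "s \<in> S"
          then obtain i where "i \<in> {1..card S}" "s = k i"
            using k unfolding bij_betw_def by blast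
          then show "s \<in> (\<lambda>i. if i \<le> card S then k i else (p0, r0)) ` {1..n}"
            using S(2) by (intro image_eqI[of _ _ i]) auto
        qed
        show "(\<lambda>i. if i \<le> card S then k i else (p0, r0)) ` {1..n} \<subseteq> S"
          using k s0 unfolding bij_betw_def by auto
      qed
      then show thesis using that by metis
    qed
    define B where "B i = {w \<in> verts H. gdist H (fst (e i)) w \<le> snd (e i)}" for i
    have eS: "(fst (e i), snd (e i)) \<in> S" if "i \<in> {1..n}" for i
      using e that by auto
    have eV: "fst (e i) \<in> verts H" if "i \<in> {1..n}" for i
      using eS[OF that] S(3) by force
    have "(\<Inter>i\<in>{1..n}. B i) \<inter> H1 \<noteq> {}"
    proof (rule assms[unfolded bipartite_helly_def, rule_format])
      show "partite_classes H H1 H2" by (rule pc)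
      show "B i \<in> balls H" if "i \<in> {1..n}" for i
        unfolding B_def balls_def using eV[OF that] by blast
      fix I assume I: "I \<subseteq> {1..n} \<and> card I = 2"
      then obtain i j where ij: "I = {i, j}" by (auto simp: card_2_iff)
      then have ij': "i \<in> {1..n}" "j \<in> {1..n}" using I by auto
      \<comment> \<open>The walk between the two centres is split after the first radius; the
        splitting vertex lies in both balls and, by parity, in \<open>H1\<close>.\<close>
      have "(fst (e i), fst (e j)) \<in> edges H ^^ (snd (e i) + snd (e j))"
        using pw eS[OF ij'(1)] eS[OF ij'(2)] by fastforce
      then obtain w where w: "(fst (e i), w) \<in> edges H ^^ snd (e i)"
          "(w, fst (e j)) \<in> edges H ^^ snd (e j)"
        by (rule relpow_addE)
      have "w \<in> verts H" using walk_verts[OF w(1)] eV ij' by blast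
      moreover have "w \<in> H1" using par[OF w(1)] cls[OF eS[OF ij'(1)]] by blast
      ultimately have "w \<in> (\<Inter>i\<in>I. B i \<inter> H1)"
        using gdist_le[OF w(1)] gdist_le[OF walk_sym[OF w(2)]] ij unfolding B_def by auto
      then show "(\<Inter>i\<in>I. B i \<inter> H1) \<noteq> {}" by blast
    qed
    then obtain y where y: "y \<in> H1" "\<And>i. i \<in> {1..n} \<Longrightarrow> y \<in> B i" by blast
    have "(y, p) \<in> edges H ^^ r" if s: "(p, r) \<in> S" for p r
    proof -
      obtain i where "i \<in> {1..n}" "e i = (p, r)" using s e by (metis imageE)
      then have "gdist H p y \<le> r" "p \<in> verts H" using y(2) eV unfolding B_def by force+
      then have "(p, y) \<in> edges H ^^ r"
        using walk_iff_gdist[OF pc] y(1) H1V cls[OF s] by blast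
      then show ?thesis by (rule walk_sym)
    qed
    then show ?thesis using y(1) H1V by blast
  qed
qed

lemma bipartite_helly_if_walk_helly:
  assumes "walk_helly n" "2 \<le> n"
  shows "bipartite_helly n 2 H"
  unfolding bipartite_helly_def
proof (intro allI impI)
  fix B H1 H2
  assume B: "\<forall>i\<in>{1..n}. B i \<in> balls H" and pc: "partite_classes H H1 H2"
    and pw: "\<forall>I. I \<subseteq> {1..n} \<and> card I = 2 \<longrightarrow> (\<Inter>i\<in>I. B i \<inter> H1) \<noteq> {}"
  note par = partite_classes_walk[OF pc edges_verts]
  have H1V: "H1 \<subseteq> verts H" using pc unfolding partite_classes_def by blast
  have "\<forall>i\<in>{1..n}. \<exists>v r. v \<in> verts H \<and> B i = {w \<in> verts H. gdist H v w \<le> r}"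
    using B unfolding balls_def by blast
  then obtain v r where v: "\<And>i. i \<in> {1..n} \<Longrightarrow> v i \<in> verts H"
      and Bi: "\<And>i. i \<in> {1..n} \<Longrightarrow> B i = {w \<in> verts H. gdist H (v i) w \<le> r i}"
    by metis
  \<comment> \<open>The distances from \<open>v i\<close> to points of \<open>H1\<close> all have
    the same parity, so a radius of the other parity can be lowered by 1 without losing a point of
    \<open>H1\<close>. If \<open>r i = 0\<close> has the wrong parity, truncation leaves
    \<open>\<rho> i = 0\<close>, but then the ball is \<open>{v i}\<close> and misses
    \<open>H1\<close>.\<close>
  define \<rho> where "\<rho> i = (if v i \<in> H1 \<longleftrightarrow> even (r i) then r i else r i - 1)" for i
  have \<rho>: "(v i, w) \<in> edges H ^^ \<rho> i" if i: "i \<in> {1..n}" and w: "w \<in> B i" "w \<in> H1" for i w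
  proof -
    have d: "gdist H (v i) w \<le> r i" and wV: "w \<in> verts H" using w Bi[OF i] by auto
    have "v i \<in> H1 \<longleftrightarrow> even (gdist H (v i) w)"
      using par[OF gdist_walk[OF v[OF i] wV]] w(2) by blast
    then have "gdist H (v i) w \<le> \<rho> i" "v i \<in> H1 \<longleftrightarrow> even (\<rho> i)"
      using d unfolding \<rho>_def by (auto simp: le_less elim: oddE)
    then show ?thesis using walk_iff_gdist[OF pc v[OF i] wV] w(2) by blast
  qed
  have meet: "\<exists>w. w \<in> B i \<inter> B j \<inter> H1" if "i \<in> {1..n}" "j \<in> {1..n}" for i j
  proof -
    \<comment> \<open>A subcollection of size 2 needs two distinct indices. For \<open>i = j\<close>
      some other index serves as partner, which exists because \<open>2 \<le> n\<close>.\<close>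
    define k where "k = (if i \<noteq> j then j else if i = 1 then 2 else 1)"
    have k: "k \<in> {1..n}" "k \<noteq> i" "i \<noteq> j \<longrightarrow> k = j"
      using that assms(2) by (auto simp: k_def)
    have "(\<Inter>l\<in>{i, k}. B l \<inter> H1) \<noteq> {}"
      using k that by (intro pw[rule_format]) auto
    then show ?thesis using k(3) by (cases "i = j") auto
  qed
  define S where "S = (\<lambda>i. (v i, \<rho> i)) ` {1..n}"
  have "finite S" "fst ` S \<subseteq> verts H" using v by (auto simp: S_def)
  moreover have "card S \<le> n"
    using card_image_le[of "{1..n}" "\<lambda>i. (v i, \<rho> i)"] by (simp add: S_def)
  moreover have "(p, q) \<in> edges H ^^ (a + b)" if "(p, a) \<in> S" "(q, b) \<in> S" for p a q b
  proof -
    obtain i j where ij: "i \<in> {1..n}" "j \<in> {1..n}" "p = v i" "a = \<rho> i" "q = v j" "b = \<rho> j"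
      using \<open>(p, a) \<in> S\<close> \<open>(q, b) \<in> S\<close> unfolding S_def by blast
    then obtain w where "w \<in> B i" "w \<in> B j" "w \<in> H1" using meet by blast
    then show ?thesis using \<rho> ij relpow_trans walk_sym by metis
  qed
  ultimately obtain y where y: "y \<in> verts H" "\<And>p r. (p, r) \<in> S \<Longrightarrow> (y, p) \<in> edges H ^^ r"
    using walk_hellyD[OF assms(1)] by metis
  have yv: "(v i, y) \<in> edges H ^^ \<rho> i" if "i \<in> {1..n}" for i
    using y(2) that walk_sym unfolding S_def by blast
  have one: "1 \<in> {1..n}" using assms(2) by simp
  \<comment> \<open>\<open>w\<close> and \<open>y\<close> both end walks of length
    \<open>\<rho> 1\<close> from \<open>v 1\<close>, so they share a class.\<close>
  obtain w where "w \<in> B 1" "w \<in> H1" using meet[OF one one] by blast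
  then have "y \<in> H1" using par[OF \<rho>[OF one]] par[OF yv[OF one]] by blast
  moreover have "y \<in> B i" if i: "i \<in> {1..n}" for i
    using gdist_le[OF yv[OF i]] y(1) Bi[OF i] unfolding \<rho>_def by (auto split: if_splits)
  ultimately show "(\<Inter>i\<in>{1..n}. B i) \<inter> H1 \<noteq> {}" by blast
qed

end

section \<open>The lattice\<close>

definition l1_dist :: "int ^ 'd \<Rightarrow> int ^ 'd \<Rightarrow> nat" where
  "l1_dist x y = (\<Sum>i\<in>UNIV. nat \<bar>x $ i - y $ i\<bar>)"

text \<open>The box spanned by \<open>x\<close> and \<open>y\<close>, which is the union of the
  lattice geodesics joining them.\<close>

definition between :: "int ^ 'd \<Rightarrow> int ^ 'd \<Rightarrow> int ^ 'd \<Rightarrow> bool" where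
  "between x m y \<longleftrightarrow> (\<forall>i. x $ i \<le> m $ i \<and> m $ i \<le> y $ i \<or> y $ i \<le> m $ i \<and> m $ i \<le> x $ i)"

lemma l1_dist_refl [simp]: "l1_dist x x = 0"
  by (simp add: l1_dist_def)

lemma l1_dist_eq_0_iff [simp]: "l1_dist x y = 0 \<longleftrightarrow> x = y"
  by (auto simp: l1_dist_def vec_eq_iff)

lemma l1_dist_commute: "l1_dist x y = l1_dist y x"
  by (simp add: l1_dist_def abs_minus_commute)

lemma l1_dist_triangle: "l1_dist x z \<le> l1_dist x y + l1_dist y z"
  unfolding l1_dist_def sum.distrib[symmetric] by (intro sum_mono) linarith

lemma l1_dist_between: "between x m y \<Longrightarrow> l1_dist x y = l1_dist x m + l1_dist m y"
  unfolding l1_dist_def sum.distrib[symmetric]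
proof (intro sum.cong refl)
  fix i
  assume "between x m y"
  then have "x $ i \<le> m $ i \<and> m $ i \<le> y $ i \<or> y $ i \<le> m $ i \<and> m $ i \<le> x $ i"
    unfolding between_def ..
  then show "nat \<bar>x $ i - y $ i\<bar> = nat \<bar>x $ i - m $ i\<bar> + nat \<bar>m $ i - y $ i\<bar>" by linarith
qed

text \<open>An integer and its absolute value have the same parity.\<close>

lemma even_l1_dist: "even (l1_dist x y) \<longleftrightarrow> even ((\<Sum>i\<in>UNIV. x $ i) - (\<Sum>i\<in>UNIV. y $ i))"
proof -
  have "int (l1_dist x y) = (\<Sum>i\<in>UNIV. \<bar>x $ i - y $ i\<bar>)" by (simp add: l1_dist_def)
  moreover have "even (\<Sum>i\<in>A. \<bar>x $ i - y $ i\<bar>) \<longleftrightarrow> even (\<Sum>i\<in>A. x $ i - y $ i)" for A :: "'a set"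
    by (induction A rule: infinite_finite_induct) auto
  ultimately show ?thesis by (metis even_of_nat sum_subtractf)
qed

lemma even_l1_dist_triangle:
  "even (l1_dist x z) \<longleftrightarrow> even (l1_dist y x + l1_dist y z)"
  by (auto simp: even_l1_dist)

lemma l1_dist_axis [simp]: "l1_dist x (x + axis i c) = nat \<bar>c\<bar>"
proof -
  have "l1_dist x (x + axis i c) = (\<Sum>j\<in>UNIV. if j = i then nat \<bar>c\<bar> else 0)"
    unfolding l1_dist_def by (intro sum.cong) (auto simp: axis_def)
  then show ?thesis by simp
qed

lemma l1_dist_axis_0 [simp]: "l1_dist 0 (axis i c) = nat \<bar>c\<bar>"
  using l1_dist_axis[of 0 i c] by simp

lemma axis_uminus: "axis i (- c) = - axis i (c :: int)"
  by (simp add: vec_eq_iff axis_def)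

lemma edges_int_lattice:
  "(x, y) \<in> edges (int_lattice :: (int ^ 'd) graph) \<longleftrightarrow> (\<exists>i. \<exists>c\<in>{1, -1}. y = x + axis i c)"
  by (auto simp: int_lattice_def axis_uminus)

lemma step_towards:
  fixes x y :: "int ^ 'd"
  assumes "x $ i \<noteq> y $ i"
  defines "x' \<equiv> x + axis i (sgn (y $ i - x $ i))"
  shows "(x, x') \<in> edges int_lattice" "between x x' y" "l1_dist x x' = 1"
proof -
  show "(x, x') \<in> edges int_lattice"
    using assms(1) unfolding edges_int_lattice x'_def by (auto simp: sgn_if)
  show "l1_dist x x' = 1" using assms(1) unfolding x'_def by (simp add: sgn_if)
  show "between x x' y"
    using assms(1) unfolding x'_def between_def by (auto simp: axis_def sgn_if)
qed

lemma l1_dist_walk: "(x, y) \<in> edges int_lattice ^^ l1_dist x y"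
proof (induction "l1_dist x y" arbitrary: x)
  case 0
  then show ?case by (metis l1_dist_eq_0_iff relpow_0_I)
next
  case (Suc n)
  then have "x \<noteq> y" by auto
  then obtain i where i: "x $ i \<noteq> y $ i" by (auto simp: vec_eq_iff)
  note s = step_towards[OF i]
  have "l1_dist x y = 1 + l1_dist (x + axis i (sgn (y $ i - x $ i))) y"
    using l1_dist_between[OF s(2)] s(3) by simp
  with Suc s(1) show ?case by (metis Suc_inject plus_1_eq_Suc relpow_Suc_I2)
qed

lemma l1_dist_le_walk: "(x, y) \<in> edges int_lattice ^^ n \<Longrightarrow> l1_dist x y \<le> n"
proof (induction n arbitrary: y)
  case (Suc n)
  then obtain z where z: "(x, z) \<in> edges int_lattice ^^ n" "(z, y) \<in> edges int_lattice" by auto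
  have "l1_dist z y = 1" using z(2) by (auto simp: edges_int_lattice)
  with Suc.IH[OF z(1)] l1_dist_triangle[of x y z] show ?case by simp
qed simp

lemma gdist_int_lattice: "gdist int_lattice x y = l1_dist x y"
  unfolding gdist_def by (rule Least_equality) (auto intro: l1_dist_walk l1_dist_le_walk)

lemma partite_classes_int_lattice:
  "partite_classes int_lattice {x :: int ^ 'd. even (l1_dist 0 x)} {x. odd (l1_dist 0 x)}"
  unfolding partite_classes_def
proof (intro conjI allI impI)
  have "0 \<in> {x :: int ^ 'd. even (l1_dist 0 x)}" by simp
  then show "{x :: int ^ 'd. even (l1_dist 0 x)} \<noteq> {}" by blast
  have "axis undefined 1 \<in> {x :: int ^ 'd. odd (l1_dist 0 x)}" by simp
  then show "{x :: int ^ 'd. odd (l1_dist 0 x)} \<noteq> {}" by blast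
  fix x y :: "int ^ 'd"
  assume "(x, y) \<in> edges int_lattice"
  then have "l1_dist x y = 1" by (auto simp: edges_int_lattice)
  then have "even (l1_dist 0 x) \<noteq> even (l1_dist 0 y)"
    using even_l1_dist_triangle[of x y 0] by simp
  then show "\<not> (x \<in> {x. even (l1_dist 0 x)} \<and> y \<in> {x. even (l1_dist 0 x)})"
    "\<not> (x \<in> {x. odd (l1_dist 0 x)} \<and> y \<in> {x. odd (l1_dist 0 x)})" by simp_all
qed (auto simp: int_lattice_def)

section \<open>Finite subsets and extreme points in the lattice\<close>

lemma dickson:
  fixes g :: "'a \<Rightarrow> 'i \<Rightarrow> nat"
  assumes "finite I"
  obtains F where "F \<subseteq> A" "finite F" "\<And>a. a \<in> A \<Longrightarrow> \<exists>b\<in>F. \<forall>i\<in>I. g b i \<le> g a i"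
proof -
  have "\<exists>F\<subseteq>A. finite F \<and> (\<forall>a\<in>A. \<exists>b\<in>F. \<forall>i\<in>I. g b i \<le> g a i)"
    using assms
  proof (induction I arbitrary: A rule: finite_induct)
    case empty
    show ?case
    proof (cases "A = {}")
      case False
      then obtain a where "a \<in> A" by blast
      then show ?thesis by (intro exI[of _ "{a}"]) auto
    qed auto
  next
    case (insert j I)
    obtain F where F: "F \<subseteq> A" "finite F" "\<forall>a\<in>A. \<exists>b\<in>F. \<forall>i\<in>I. g b i \<le> g a i"
      using insert.IH by blast
    \<comment> \<open>Points whose \<open>j\<close>-th value is at least \<open>M\<close> are
      dominated by \<open>F\<close>. The others fall into finitely many slices on which the
      \<open>j\<close>-th value is constant, and the induction hypothesis applies to each
      slice.\<close>
    obtain M where M: "\<forall>b\<in>F. g b j \<le> M"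
      using finite_nat_set_iff_bounded_le[of "(\<lambda>b. g b j) ` F"] F(2) by auto
    have "\<forall>k. \<exists>F. F \<subseteq> {a\<in>A. g a j = k} \<and> finite F \<and>
        (\<forall>a\<in>{a\<in>A. g a j = k}. \<exists>b\<in>F. \<forall>i\<in>I. g b i \<le> g a i)"
      using insert.IH by blast
    from choice[OF this] obtain F' where "\<forall>k. F' k \<subseteq> {a\<in>A. g a j = k} \<and> finite (F' k) \<and>
        (\<forall>a\<in>{a\<in>A. g a j = k}. \<exists>b\<in>F' k. \<forall>i\<in>I. g b i \<le> g a i)" ..
    then have F': "F' k \<subseteq> {a\<in>A. g a j = k}" "finite (F' k)"
        "\<forall>a\<in>{a\<in>A. g a j = k}. \<exists>b\<in>F' k. \<forall>i\<in>I. g b i \<le> g a i" for k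
      by simp_all
    have "\<exists>b\<in>F \<union> (\<Union>k<M. F' k). \<forall>i\<in>insert j I. g b i \<le> g a i" if a: "a \<in> A" for a
    proof (cases "g a j < M")
      case True
      obtain b where "b \<in> F' (g a j)" "\<forall>i\<in>I. g b i \<le> g a i"
        using F'(3)[of "g a j"] a by auto
      moreover from this have "g b j = g a j" using F'(1) by blast
      ultimately show ?thesis using True by (intro bexI[of _ b]) auto
    next
      case False
      obtain b where b: "b \<in> F" "\<forall>i\<in>I. g b i \<le> g a i" using F(3) a by blast
      moreover have "g b j \<le> g a j" using M b(1) False by fastforce
      ultimately show ?thesis by blast
    qed
    moreover have "F \<union> (\<Union>k<M. F' k) \<subseteq> A" using F(1) F'(1) by blast
    moreover have "finite (F \<union> (\<Union>k<M. F' k))" using F(2) F'(2) by blast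
    ultimately show ?case by blast
  qed
  then show thesis using that by blast
qed

lemma finite_between_subset:
  fixes x :: "int ^ 'd"
  obtains F where "F \<subseteq> A" "finite F" "\<forall>a\<in>A. \<exists>b\<in>F. between x b a"
proof -
  \<comment> \<open>The positive and negative parts of the coordinates of \<open>a - x\<close>. In
    each coordinate one of the two parts vanishes for \<open>a\<close>, so domination puts
    \<open>b $ i\<close> between \<open>x $ i\<close> and \<open>a $ i\<close>.\<close>
  define g where "g a = (\<lambda>(i, s). if s then nat (a $ i - x $ i) else nat (x $ i - a $ i))"
    for a :: "int ^ 'd"
  obtain F where F: "F \<subseteq> A" "finite F" "\<And>a. a \<in> A \<Longrightarrow> \<exists>b\<in>F. \<forall>i\<in>UNIV. g b i \<le> g a i"
    by (rule dickson[of UNIV A g]) auto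
  have btw: "between x b a" if "\<forall>i\<in>UNIV. g b i \<le> g a i" for a b
    unfolding between_def
  proof
    fix i
    have "g b (i, s) \<le> g a (i, s)" for s using that by blast
    from this[of True] this[of False]
    show "x $ i \<le> b $ i \<and> b $ i \<le> a $ i \<or> a $ i \<le> b $ i \<and> b $ i \<le> x $ i"
      by (simp add: g_def) linarith
  qed
  show thesis
  proof (rule that[OF F(1,2)], rule ballI)
    fix a assume "a \<in> A"
    from F(3)[OF this] show "\<exists>b\<in>F. between x b a" by (blast intro: btw)
  qed
qed

text \<open>Pigeonhole: otherwise every point is the unique extreme point in one of the
  \<open>2 * CARD('d)\<close> directions, and a direction has at most one unique extreme
  point.\<close>

lemma exists_nonextreme_point:
  fixes A :: "(int ^ 'd) set"
  assumes "finite A" "2 * CARD('d) < card A"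
  obtains a where "a \<in> A" "\<forall>i. \<exists>b\<in>A - {a}. a $ i \<le> b $ i" "\<forall>i. \<exists>b\<in>A - {a}. b $ i \<le> a $ i"
proof (rule ccontr)
  assume *: "\<not> thesis"
  \<comment> \<open>The direction \<open>(i, True)\<close> marks a strict maximum of coordinate
    \<open>i\<close>, and \<open>(i, False)\<close> a strict minimum.\<close>
  have "\<forall>a\<in>A. \<exists>k. case k of (i, s) \<Rightarrow>
      \<forall>b\<in>A - {a}. if s then b $ i < a $ i else a $ i < b $ i"
  proof
    fix a assume "a \<in> A"
    with * that obtain i where "(\<forall>b\<in>A - {a}. b $ i < a $ i) \<or> (\<forall>b\<in>A - {a}. a $ i < b $ i)"
      by (meson not_le)
    then show "\<exists>k. case k of (i, s) \<Rightarrow>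
        \<forall>b\<in>A - {a}. if s then b $ i < a $ i else a $ i < b $ i"
    proof
      assume "\<forall>b\<in>A - {a}. b $ i < a $ i"
      then show ?thesis by (intro exI[of _ "(i, True)"]) simp
    next
      assume "\<forall>b\<in>A - {a}. a $ i < b $ i"
      then show ?thesis by (intro exI[of _ "(i, False)"]) simp
    qed
  qed
  from bchoice[OF this] obtain k where k: "\<forall>a\<in>A. case k a of (i, s) \<Rightarrow>
      \<forall>b\<in>A - {a}. if s then b $ i < a $ i else a $ i < b $ i" ..
  have "inj_on k A"
  proof (rule inj_onI, rule ccontr)
    fix a b assume ab: "a \<in> A" "b \<in> A" "k a = k b" "a \<noteq> b"
    obtain i s where "k a = (i, s)" by fastforce
    with ab k[rule_format, OF ab(1)] k[rule_format, OF ab(2)] have "if s then b $ i < a $ i else a $ i < b $ i"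
        "if s then a $ i < b $ i else b $ i < a $ i" by auto
    then show False by (auto split: if_splits)
  qed
  then have "card A \<le> CARD('d \<times> bool)" by (rule card_inj_on_le) auto
  then show False using assms(2) by simp
qed

section \<open>Extension of maps\<close>

context connected_bipartite_graph
begin

text \<open>Covers the Lipschitz bound and compatibility with the classes at once. On
  \<open>UNIV\<close> it characterises homomorphisms.\<close>

definition walk_lipschitz :: "(int ^ 'd) set \<Rightarrow> (int ^ 'd \<Rightarrow> 'v) \<Rightarrow> bool" where
  "walk_lipschitz A f \<longleftrightarrow>
     f ` A \<subseteq> verts H \<and> (\<forall>x\<in>A. \<forall>y\<in>A. (f x, f y) \<in> edges H ^^ l1_dist x y)"

definition extends_at :: "(int ^ 'd) set \<Rightarrow> (int ^ 'd \<Rightarrow> 'v) \<Rightarrow> int ^ 'd \<Rightarrow> 'v \<Rightarrow> bool" where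
  "extends_at A f x z \<longleftrightarrow> z \<in> verts H \<and> (\<forall>a\<in>A. (z, f a) \<in> edges H ^^ l1_dist x a)"

lemma walk_lipschitz_subset: "walk_lipschitz A f \<Longrightarrow> B \<subseteq> A \<Longrightarrow> walk_lipschitz B f"
  unfolding walk_lipschitz_def by blast

text \<open>The walk from \<open>z\<close> to \<open>f b\<close> followed by the one from
  \<open>f b\<close> to \<open>f a\<close> has the right total length, as \<open>b\<close> lies on a
  geodesic from \<open>x\<close> to \<open>a\<close>.\<close>

lemma extends_at_between:
  assumes "walk_lipschitz A f" "B \<subseteq> A" "extends_at B f x z" "\<And>a. a \<in> A \<Longrightarrow> \<exists>b\<in>B. between x b a"
  shows "extends_at A f x z"
  unfolding extends_at_def
proof (intro conjI ballI)
  show "z \<in> verts H" using assms(3) by (simp add: extends_at_def)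
  fix a assume "a \<in> A"
  with assms(4) obtain b where b: "b \<in> B" "between x b a" by blast
  have "(z, f b) \<in> edges H ^^ l1_dist x b" "(f b, f a) \<in> edges H ^^ l1_dist b a"
    using assms(1-3) b(1) \<open>a \<in> A\<close> unfolding extends_at_def walk_lipschitz_def by blast+
  then show "(z, f a) \<in> edges H ^^ l1_dist x a"
    unfolding l1_dist_between[OF b(2)] by (rule relpow_trans)
qed

lemma walk_lipschitz_fun_upd:
  assumes "walk_lipschitz A f" "extends_at A f x z"
  shows "walk_lipschitz (insert x A) (f(x := z))"
  using assms walk_sym unfolding walk_lipschitz_def extends_at_def
  by (auto simp: l1_dist_commute[of _ x])

text \<open>The new point may already belong to \<open>A\<close>; a walk of length 0 then forces
  \<open>z = f x\<close>.\<close>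

lemma extends_at_fun_upd:
  assumes "extends_at A f x z" "a \<in> A"
  shows "(f(x := z)) a = f a"
  using assms unfolding extends_at_def by (cases "a = x") auto

lemma one_point_extension_finite:
  fixes A :: "(int ^ 'd) set"
  assumes helly: "walk_helly (2 * CARD('d))" and "finite A" "walk_lipschitz A f"
  shows "\<exists>z. extends_at A f x z"
  using assms(2,3)
proof (induction "card A" arbitrary: A f x rule: less_induct)
  case (less A f x)
  have fV: "f a \<in> verts H" if "a \<in> A" for a
    using less.prems(2) that unfolding walk_lipschitz_def by blast
  show ?case
  proof (cases "card A \<le> 2 * CARD('d)")
    case True
    \<comment> \<open>The value sought at \<open>x\<close> must lie at the end of walks of these
      lengths from the prescribed values.\<close>
    define S where "S = (\<lambda>a. (f a, l1_dist x a)) ` A"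
    have "finite S" "fst ` S \<subseteq> verts H" using fV less.prems(1) by (auto simp: S_def)
    moreover have "card S \<le> 2 * CARD('d)"
      using True card_image_le[OF less.prems(1), of "\<lambda>a. (f a, l1_dist x a)"] unfolding S_def by simp
    moreover have "(p, q) \<in> edges H ^^ (r + s)" if "(p, r) \<in> S" "(q, s) \<in> S" for p r q s
    proof -
      obtain a b where ab: "a \<in> A" "b \<in> A" and [simp]: "p = f a" "r = l1_dist x a"
        "q = f b" "s = l1_dist x b" using \<open>(p, r) \<in> S\<close> \<open>(q, s) \<in> S\<close> unfolding S_def by blast
      have "(f a, f b) \<in> edges H ^^ l1_dist a b"
        using ab less.prems(2) unfolding walk_lipschitz_def by blast
      \<comment> \<open>The triangle inequality and parity allow the walk of length
        \<open>l1_dist a b\<close> to be lengthened to pass from one radius to the sum of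
        both.\<close>
      then show ?thesis
        using walk_extend[OF _ fV[OF ab(1)]] l1_dist_triangle[of a b x]
          even_l1_dist_triangle[of a b x] l1_dist_commute[of a x] by simp
    qed
    ultimately obtain z where "z \<in> verts H" "\<And>p r. (p, r) \<in> S \<Longrightarrow> (z, p) \<in> edges H ^^ r"
      using walk_hellyD[OF helly] by metis
    then show ?thesis unfolding extends_at_def S_def by blast
  next
    case False
    then have "2 * CARD('d) < card A" by simp
    from exists_nonextreme_point[OF less.prems(1) this]
    obtain a where a: "a \<in> A" "\<forall>i. \<exists>b\<in>A - {a}. a $ i \<le> b $ i"
        "\<forall>i. \<exists>b\<in>A - {a}. b $ i \<le> a $ i" .
    \<comment> \<open>Inner induction on the distance from \<open>x\<close> to \<open>a\<close>,
      with \<open>A\<close>, \<open>f\<close> and \<open>a\<close> fixed. The outer hypothesis, for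
      smaller sets, admits any map and any point.\<close>
    show ?thesis
    proof (induction "l1_dist x a" arbitrary: x)
      case 0
      then have "x = a" using l1_dist_eq_0_iff by metis
      then have "extends_at A f x (f a)"
        using a(1) fV less.prems(2) unfolding extends_at_def walk_lipschitz_def by blast
      then show ?case by blast
    next
      case (Suc n)
      then have "x \<noteq> a" by auto
      then obtain i where i: "x $ i \<noteq> a $ i" by (auto simp: vec_eq_iff)
      define x' where "x' = x + axis i (sgn (a $ i - x $ i))"
      note s = step_towards[OF i, folded x'_def]
      have "l1_dist x' a = n" using l1_dist_between[OF s(2)] s(3) Suc.hyps(2) by simp
      then obtain z' where z': "extends_at A f x' z'" using Suc.hyps(1) by metis
      \<comment> \<open>As \<open>a\<close> is not the unique extreme point in the direction of the
        step, some other \<open>b\<close> lies at least as far in that direction.\<close>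
      obtain b where b: "b \<in> A - {a}" "x $ i < a $ i \<and> a $ i \<le> b $ i \<or> b $ i \<le> a $ i \<and> a $ i < x $ i"
        using a(2)[THEN spec, of i] a(3)[THEN spec, of i] i by (metis linorder_neqE)
      then have btw: "between x x' b"
        unfolding x'_def between_def by (auto simp: axis_def sgn_if)
      \<comment> \<open>Two distinct points leave and at most one enters, so the set
        shrinks.\<close>
      define A' where "A' = insert x' (A - {a, b})"
      define f' where "f' = f(x' := z')"
      have f'A: "f' c = f c" if "c \<in> A" for c
        unfolding f'_def using extends_at_fun_upd[OF z' that] .
      have lip: "walk_lipschitz (insert x' A) f'"
        unfolding f'_def using walk_lipschitz_fun_upd[OF less.prems(2) z'] .
      have "card A' < card A"
      proof -
        have "card (A - {a, b}) = card A - 2" "card A \<ge> 2"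
          using a(1) b(1) less.prems(1) card_mono[of A "{a, b}"] by (auto simp: card_Diff_subset)
        moreover have "card A' \<le> Suc (card (A - {a, b}))"
          unfolding A'_def by (rule card_insert_le_m1) simp_all
        ultimately show ?thesis by linarith
      qed
      moreover have "finite A'" using less.prems(1) by (simp add: A'_def)
      moreover have "walk_lipschitz A' f'"
        by (rule walk_lipschitz_subset[OF lip]) (auto simp: A'_def)
      ultimately obtain z where "extends_at A' f' x z" using less.hyps[of A' f' x] by blast
      \<comment> \<open>The point \<open>x'\<close> serves for \<open>a\<close> and
        \<open>b\<close>, and any other point serves for itself.\<close>
      moreover have "\<exists>d\<in>A'. between x d c" if "c \<in> insert x' A" for c
        using that s(2) btw unfolding A'_def by (cases "c \<in> {a, b}") (auto simp: between_def)
      moreover have "A' \<subseteq> insert x' A" by (auto simp: A'_def)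
      ultimately have "extends_at (insert x' A) f' x z"
        using extends_at_between[OF lip] by metis
      then have "extends_at A f x z" using f'A unfolding extends_at_def by auto
      then show ?case by blast
    qed
  qed
qed

lemma one_point_extension:
  fixes A :: "(int ^ 'd) set"
  assumes "walk_helly (2 * CARD('d))" "walk_lipschitz A f"
  shows "\<exists>z. extends_at A f x z"
proof -
  obtain F where F: "F \<subseteq> A" "finite F" "\<forall>a\<in>A. \<exists>b\<in>F. between x b a"
    by (rule finite_between_subset)
  obtain z where "extends_at F f x z"
    using one_point_extension_finite[OF assms(1) F(2) walk_lipschitz_subset[OF assms(2) F(1)]] ..
  from extends_at_between[OF assms(2) F(1) this F(3)[rule_format]] show ?thesis ..
qed

section \<open>From one point to the whole lattice\<close>

lemma countable_UNIV_int_vec: "countable (UNIV :: (int ^ 'd) set)"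
proof -
  have "countable (Pi\<^sub>E (UNIV :: 'd set) (\<lambda>_. UNIV :: int set))"
    by (intro countable_PiE) auto
  moreover have "inj vec_nth" by (auto simp: inj_def vec_nth_inject)
  ultimately show ?thesis by (auto intro: countable_image_inj_on countable_subset simp: PiE_UNIV_domain)
qed

text \<open>The points of an enumeration of the lattice are added one at a time. Values already
  assigned never change, so the stages have a limit.\<close>

lemma full_extension:
  fixes A :: "(int ^ 'd) set"
  assumes "walk_helly (2 * CARD('d))" "walk_lipschitz A f"
  obtains h where "walk_lipschitz UNIV h" "\<And>a. a \<in> A \<Longrightarrow> h a = f a"
proof -
  define pt where "pt = (from_nat_into UNIV :: nat \<Rightarrow> int ^ 'd)"
  define idx where "idx = (to_nat_on UNIV :: int ^ 'd \<Rightarrow> nat)"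
  have pt_idx: "pt (idx x) = x" for x
    unfolding pt_def idx_def using countable_UNIV_int_vec by simp
  define A' where "A' n = A \<union> pt ` {..<n}" for n
  have A'_Suc: "A' (Suc n) = insert (pt n) (A' n)" for n
    by (auto simp: A'_def lessThan_Suc)
  have "\<exists>F. \<forall>n. (walk_lipschitz (A' n) (F n) \<and> (\<forall>a\<in>A. F n a = f a)) \<and> (\<forall>a\<in>A' n. F (Suc n) a = F n a)"
  proof (rule dependent_nat_choice)
    show "\<exists>g. walk_lipschitz (A' 0) g \<and> (\<forall>a\<in>A. g a = f a)"
      using assms(2) by (auto simp: A'_def)
    fix g n assume g: "walk_lipschitz (A' n) g \<and> (\<forall>a\<in>A. g a = f a)"
    then obtain z where z: "extends_at (A' n) g (pt n) z"
      using one_point_extension[OF assms(1)] by blast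
    have "walk_lipschitz (A' (Suc n)) (g(pt n := z))"
      unfolding A'_Suc using g z walk_lipschitz_fun_upd by blast
    moreover have "\<forall>a\<in>A' n. (g(pt n := z)) a = g a" using extends_at_fun_upd[OF z] by blast
    moreover from this have "\<forall>a\<in>A. (g(pt n := z)) a = f a" using g by (simp add: A'_def)
    ultimately show "\<exists>g'. (walk_lipschitz (A' (Suc n)) g' \<and> (\<forall>a\<in>A. g' a = f a)) \<and> (\<forall>a\<in>A' n. g' a = g a)"
      by blast
  qed
  then obtain F where F: "\<And>n. walk_lipschitz (A' n) (F n)" "\<And>n a. a \<in> A \<Longrightarrow> F n a = f a"
      "\<And>n a. a \<in> A' n \<Longrightarrow> F (Suc n) a = F n a" by blast
  have mono: "a \<in> A' n \<Longrightarrow> n \<le> m \<Longrightarrow> a \<in> A' m" for a n m by (auto simp: A'_def)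
  have stable: "F m a = F n a" if "n \<le> m" "a \<in> A' n" for m n a
    using that by (induction m rule: dec_induct) (auto simp: F(3) mono)
  \<comment> \<open>The point \<open>x\<close> has entered the domain by stage
    \<open>Suc (idx x)\<close>, and every later stage agrees there.\<close>
  define h where "h x = F (Suc (idx x)) x" for x
  have mem: "x \<in> A' (Suc (idx x))" for x
    unfolding A'_Suc by (simp add: pt_idx)
  have hF: "h x = F n x" if "idx x < n" for x n
    unfolding h_def using stable[OF Suc_leI[OF that] mem] by (rule sym)
  have "walk_lipschitz UNIV h"
    unfolding walk_lipschitz_def
  proof (intro conjI ballI subsetI)
    fix x y
    \<comment> \<open>A common stage at which both points are already in the domain.\<close>
    define n where "n = Suc (max (idx x) (idx y))"
    have n: "idx x < n" "idx y < n" by (auto simp: n_def)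
    then have "x \<in> A' n" "y \<in> A' n" using mono[OF mem] by (simp_all add: Suc_leI)
    then show "(h x, h y) \<in> edges H ^^ l1_dist x y"
      using F(1)[of n] n hF unfolding walk_lipschitz_def by metis
  next
    fix v assume "v \<in> range h"
    then show "v \<in> verts H" using F(1) mem unfolding h_def walk_lipschitz_def by blast
  qed
  moreover have "h a = f a" if "a \<in> A" for a unfolding h_def using F(2) that .
  ultimately show thesis using that by blast
qed

section \<open>Kirszbraun property and walk form of the Helly property\<close>

lemma kirszbraun_if_walk_helly:
  assumes "walk_helly (2 * CARD('d))"
  shows "bipartite_kirszbraun (int_lattice :: (int ^ 'd) graph) H"
  unfolding bipartite_kirszbraun_def
proof (intro allI impI)
  fix G1 G2 :: "(int ^ 'd) set" and H1 H2 and A :: "(int ^ 'd) set" and f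
  assume G: "partite_classes int_lattice G1 G2" and pc: "partite_classes H H1 H2"
    and fV: "f ` A \<subseteq> verts H"
    and lip: "\<forall>x\<in>A. \<forall>y\<in>A. gdist H (f x) (f y) \<le> gdist int_lattice x y"
    and cls: "f ` (A \<inter> G1) \<subseteq> H1" "f ` (A \<inter> G2) \<subseteq> H2"
  have EV: "edges int_lattice \<subseteq> verts (int_lattice :: (int ^ 'd) graph) \<times> verts int_lattice"
    by (auto simp: int_lattice_def)
  have G_UN: "G1 \<union> G2 = UNIV" using G unfolding partite_classes_def int_lattice_def by simp
  have H_disj: "H1 \<inter> H2 = {}" using pc unfolding partite_classes_def by blast
  have "walk_lipschitz A f"
    unfolding walk_lipschitz_def
  proof (intro conjI ballI fV)
    fix x y assume xy: "x \<in> A" "y \<in> A"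
    \<comment> \<open>The map matches the classes exactly, so the parity of a lattice distance
      decides whether the two images share a class.\<close>
    have iff: "f a \<in> H1 \<longleftrightarrow> a \<in> G1" if "a \<in> A" for a
      using cls G_UN H_disj that by blast
    have "gdist H (f x) (f y) \<le> l1_dist x y" using lip xy by (simp add: gdist_int_lattice)
    moreover have "f x \<in> H1 \<longleftrightarrow> (f y \<in> H1 \<longleftrightarrow> even (l1_dist x y))"
      using partite_classes_walk[OF G EV l1_dist_walk[of x y]] iff[OF xy(1)] iff[OF xy(2)] by simp
    moreover have "f x \<in> verts H" "f y \<in> verts H" using fV xy by blast+
    ultimately show "(f x, f y) \<in> edges H ^^ l1_dist x y"
      by (simp add: walk_iff_gdist[OF pc])
  qed
  with full_extension[OF assms] obtain h
    where h: "walk_lipschitz UNIV h" "\<And>a. a \<in> A \<Longrightarrow> h a = f a" by metis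
  have "h \<in> graph_homs int_lattice H"
    unfolding graph_homs_def
  proof (intro CollectI conjI ballI allI impI)
    show "h x \<in> verts H" for x using h(1) unfolding walk_lipschitz_def by blast
    fix x y assume "(x, y) \<in> edges (int_lattice :: (int ^ 'd) graph)"
    then have "l1_dist x y = 1" by (auto simp: edges_int_lattice)
    then show "(h x, h y) \<in> edges H"
      using h(1) unfolding walk_lipschitz_def by (metis UNIV_I relpow_1)
  qed
  then show "\<exists>h\<in>graph_homs int_lattice H. \<forall>x\<in>A. h x = f x" using h(2) by blast
qed

text \<open>A ball of radius \<open>r\<close> is represented by a lattice point at distance \<open>r\<close> from the origin, on its
  own half-axis.\<close>

lemma walk_helly_if_kirszbraun:
  assumes "bipartite_kirszbraun (int_lattice :: (int ^ 'd) graph) H"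
  shows "walk_helly (2 * CARD('d))"
  unfolding walk_helly_def
proof (intro allI impI)
  fix S :: "('v \<times> nat) set"
  assume S: "finite S" "card S \<le> 2 * CARD('d)" "fst ` S \<subseteq> verts H"
    and pw: "\<forall>(p, r)\<in>S. \<forall>(q, s)\<in>S. (p, q) \<in> edges H ^^ (r + s)"
  show "\<exists>y\<in>verts H. \<forall>(p, r)\<in>S. (y, p) \<in> edges H ^^ r"
  proof (cases "S = {}")
    case True
    then show ?thesis using verts_nonempty by auto
  next
    case False
    then obtain p0 r0 where s0: "(p0, r0) \<in> S" by auto
    then have "p0 \<in> verts H" using S(3) by force
    \<comment> \<open>\<open>H1\<close> is to be matched with the even lattice points: the
      representative of \<open>(p, r)\<close> lies at distance \<open>r\<close> from the origin, and
      \<open>p \<in> H1\<close> must hold iff \<open>r\<close> is even.\<close>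
    then obtain H1 H2 where pc: "partite_classes H H1 H2" and p0: "p0 \<in> H1 \<longleftrightarrow> even r0"
      by (rule labelling_exists)
    note par = partite_classes_walk[OF pc edges_verts]
    have H12: "verts H = H1 \<union> H2" using pc unfolding partite_classes_def by blast
    have pw': "(fst s, fst t) \<in> edges H ^^ (snd s + snd t)" if "s \<in> S" "t \<in> S" for s t
      using pw that by fastforce
    have cls: "fst s \<in> H1 \<longleftrightarrow> even (snd s)" if "s \<in> S" for s
      using pw'[OF s0 that] p0 par[of p0 "fst s" "r0 + snd s"] by auto
    \<comment> \<open>The type \<open>'d \<times> bool\<close> indexes the half-axes, and
      \<open>g\<close> gives each pair of \<open>S\<close> its own.\<close>
    have "card S \<le> card (UNIV :: ('d \<times> bool) set)" using S(2) by simp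
    then obtain g :: "'v \<times> nat \<Rightarrow> 'd \<times> bool" where g: "inj_on g S"
      using card_le_inj[OF S(1) finite_class.finite_UNIV] by blast
    define pt where "pt s = (axis (fst (g s)) (if snd (g s) then int (snd s) else - int (snd s)) :: int ^ 'd)"
      for s
    have pt0: "l1_dist 0 (pt s) = snd s" for s by (simp add: pt_def)
    have dist: "l1_dist (pt s) (pt t) = snd s + snd t" if "s \<in> S" "t \<in> S" "s \<noteq> t" for s t
    proof -
      \<comment> \<open>The origin lies in the box spanned by points on different half-axes, so
        their distances to it add up.\<close>
      have "g s \<noteq> g t" using g that by (auto dest: inj_onD)
      then have "between (pt s) 0 (pt t)"
        unfolding between_def pt_def by (auto simp: axis_def prod_eq_iff)
      from l1_dist_between[OF this] show ?thesis by (simp add: pt0 l1_dist_commute[of _ 0])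
    qed
    \<comment> \<open>Representatives can coincide only at the origin, with both radii 0; the walk
      of length 0 then identifies the centres.\<close>
    have inj: "inj_on pt S"
    proof (rule inj_onI, rule ccontr)
      fix s t assume st: "s \<in> S" "t \<in> S" "pt s = pt t" "s \<noteq> t"
      then have "snd s + snd t = 0" using dist[of s t] by simp
      with pw'[OF st(1,2)] st(4) show False by (auto simp: prod_eq_iff)
    qed
    define f where "f x = fst (inv_into S pt x)" for x
    have f: "f (pt s) = fst s" if "s \<in> S" for s
      using inj that by (simp add: f_def)
    have "\<exists>h\<in>graph_homs int_lattice H. \<forall>x\<in>pt ` S. h x = f x"
    proof (rule assms[unfolded bipartite_kirszbraun_def, rule_format])
      show "partite_classes int_lattice {x :: int ^ 'd. even (l1_dist 0 x)} {x. odd (l1_dist 0 x)}"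
        by (rule partite_classes_int_lattice)
      show "partite_classes H H1 H2" by (rule pc)
      show "pt ` S \<subseteq> verts int_lattice" by (simp add: int_lattice_def)
      show "f ` pt ` S \<subseteq> verts H" using f S(3) by auto
      show "f ` (pt ` S \<inter> {x. even (l1_dist 0 x)}) \<subseteq> H1" using f cls pt0 by auto
      show "f ` (pt ` S \<inter> {x. odd (l1_dist 0 x)}) \<subseteq> H2" using f cls pt0 S(3) H12 by fastforce
      fix x y assume "x \<in> pt ` S" "y \<in> pt ` S"
      then obtain s t where st: "s \<in> S" "t \<in> S" "x = pt s" "y = pt t" by blast
      show "gdist H (f x) (f y) \<le> gdist int_lattice x y"
      proof (cases "s = t")
        case True
        then show ?thesis using st gdist_le[where u = "f x" and v = "f y" and G = H and n = 0] by simp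
      next
        case False
        then show ?thesis using st gdist_le[OF pw'] by (simp add: f gdist_int_lattice dist)
      qed
    qed
    then obtain h where h: "h \<in> graph_homs int_lattice H" "\<And>s. s \<in> S \<Longrightarrow> h (pt s) = fst s"
      using f by auto
    \<comment> \<open>The value at the origin is the common vertex, as \<open>h\<close> carries a
      walk from the origin to a representative to one of the same length.\<close>
    have "(h 0, fst s) \<in> edges H ^^ snd s" if "s \<in> S" for s
      using graph_homs_relpow[OF h(1) l1_dist_walk[of 0 "pt s"]] h(2) that pt0 by simp
    moreover have "h 0 \<in> verts H" using h(1) unfolding graph_homs_def int_lattice_def by simp
    ultimately show ?thesis by fastforce
  qed
qed

end

theorem theorem4p6:
  fixes H :: "'v graph"
  assumes "simple_connected_graph H" and "bipartite H"
  shows "bipartite_kirszbraun (int_lattice :: (int ^ 'd) graph) H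
         \<longleftrightarrow> bipartite_helly (2 * CARD('d)) 2 H"
proof -
  interpret connected_bipartite_graph H by unfold_locales fact+
  have "2 \<le> 2 * CARD('d)" by (simp add: Suc_leI)
  then show ?thesis
    using walk_helly_if_kirszbraun kirszbraun_if_walk_helly
      walk_helly_if_bipartite_helly bipartite_helly_if_walk_helly by blast
qed

end
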